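(* Let $S$ be an Arf numerical semigroup with multiplicity $3$ and conductor $s\ge 3$. If $s\equiv 0\bmod 3$, then $S=\langle 3,s+1,s+2\rangle$, $\mathrm{PF}(S)=\{s-2,s-1\}$, and the unique row-factorization matrices of $s-2$ and of $s-1$ are, respectively, \[\begin{bmatrix}-1&1&0\\ \frac{s-3}{3}&-1&1\\ \frac{2s}{3}&0&-1\end{bmatrix}\quad\text{and}\quad \begin{bmatrix}-1&0&1\\ \frac{2s}{3}&-1&0\\ \frac{s}{3}&1&-1\end{bmatrix}.\]
   Context: A numerical semigroup is a subset $S\subseteq\mathbb{N}_0$ (non-negative integers) containing $0$, closed under addition, with finite complement in $\mathbb{N}_0$; $\langle A\rangle$ is the set of $\mathbb{N}_0$-linear combinations of elements of $A$. The multiplicity is the smallest nonzero element of $S$; the conductor is one plus the greatest integer not in $S$. $S$ is Arf if $s_2+s_3-s_1\in S$ for all $s_1\le s_2\le s_3$ in $S$. $\mathrm{PF}(S)$ is the set of integers $z\notin S$ with $z+x\in S$ for all nonzero $x\in S$. If $n_1<\dots<n_e$ are the minimal generators of $S$, a row-factorization matrix of $f\in\mathrm{PF}(S)$ is an $e\times e$ integer matrix $[a_{ij}]$ with $a_{ii}=-1$, $a_{ij}\in\mathbb{N}_0$ for $i\ne j$, and $f=\sum_{j=1}^e a_{ij}n_j$ for each $i$. *)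

theory Defs
  imports "HOL-Number_Theory.Cong" "Jordan_Normal_Form.Matrix"
begin

definition numerical_semigroup :: "nat set \<Rightarrow> bool" where
  "numerical_semigroup S \<longleftrightarrow>
     0 \<in> S \<and> (\<forall>x\<in>S. \<forall>y\<in>S. x + y \<in> S) \<and> finite (- S)"

definition semigroup_span :: "nat set \<Rightarrow> nat set" where
  "semigroup_span A = {\<Sum>a\<in>F. c a * a | F c. finite F \<and> F \<subseteq> A}"

definition multiplicity_sg :: "nat set \<Rightarrow> nat" where
  "multiplicity_sg S = (LEAST n. n \<in> S \<and> n \<noteq> 0)"

text \<open>The greatest gap is taken over the integers, so that it is -1, and the
  conductor is 0, when the semigroup contains every natural number.\<close>

definition conductor :: "nat set \<Rightarrow> int" where
  "conductor S = 1 + (GREATEST z :: int. z \<notin> int ` S)"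

text \<open>The natural-number subtraction does not truncate, because of the order constraints.\<close>

definition arf :: "nat set \<Rightarrow> bool" where
  "arf S \<longleftrightarrow>
     (\<forall>s1\<in>S. \<forall>s2\<in>S. \<forall>s3\<in>S. s1 \<le> s2 \<and> s2 \<le> s3 \<longrightarrow> s2 + s3 - s1 \<in> S)"

definition pseudo_frobenius :: "nat set \<Rightarrow> int set" where
  "pseudo_frobenius S =
     {z. z \<notin> int ` S \<and> (\<forall>x\<in>S. x \<noteq> 0 \<longrightarrow> z + int x \<in> int ` S)}"

definition minimal_generating_set :: "nat set \<Rightarrow> nat set \<Rightarrow> bool" where
  "minimal_generating_set S A \<longleftrightarrow>
     semigroup_span A = S \<and> (\<forall>B. B \<subset> A \<longrightarrow> semigroup_span B \<noteq> S)"

text \<open>The list \<open>ns\<close> is the increasing enumeration of the minimal generators; a numerical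
  semigroup has exactly one minimal generating set, and it is finite. Rows and columns are
  indexed from 0.\<close>

definition is_row_factorization_matrix :: "nat set \<Rightarrow> int \<Rightarrow> int mat \<Rightarrow> bool" where
  "is_row_factorization_matrix S f M \<longleftrightarrow>
     f \<in> pseudo_frobenius S \<and>
     (\<exists>ns. sorted_wrt (<) ns \<and> minimal_generating_set S (set ns) \<and>
        M \<in> carrier_mat (length ns) (length ns) \<and>
        (\<forall>i < length ns.
           M $$ (i, i) = -1 \<and>
           (\<forall>j < length ns. j \<noteq> i \<longrightarrow> 0 \<le> M $$ (i, j)) \<and>
           f = (\<Sum>j < length ns. M $$ (i, j) * int (ns ! j))))"

end

theory Submission
  imports Defs
begin

text \<open>
  Write \<open>s = 3 k\<close>. The semigroup \<open>S\<close> contains all multiples of \<open>3\<close> and every number from \<open>s\<close>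
  on, but not \<open>s - 1\<close>. It contains no other number: an element congruent to \<open>2\<close> modulo \<open>3\<close> below
  \<open>s\<close> would reach \<open>s - 1\<close> by adding multiples of \<open>3\<close>, and an element \<open>3 m + 1\<close> below \<open>s\<close> would
  yield \<open>2 (3 m + 1) - 3 m = 3 m + 2\<close> by the Arf property (\<open>arf_multiplicity_3_eq\<close>).

  Each of \<open>3\<close>, \<open>s + 1\<close>, \<open>s + 2\<close> is then irreducible in \<open>S\<close>, meaning that it is nonzero and not a
  sum of two nonzero elements. An irreducible element lies in every generating set
  (\<open>irreducible_in_generating_set\<close>), and these three generate \<open>S\<close>, so they form the only minimal
  generating set. The pseudo-Frobenius numbers can be read off from the explicit form of \<open>S\<close>.

  In a row-factorization matrix of \<open>s - 2\<close> or \<open>s - 1\<close>, a row states that a number is a combination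
  of two of the generators with nonnegative coefficients. That number is at most \<open>2 s + 1\<close>, which
  is less than twice \<open>s + 1\<close>, so the coefficients of \<open>s + 1\<close> and \<open>s + 2\<close> can only be \<open>0\<close> or \<open>1\<close>.
  Which of the two occurs is decided by size in the first row, where only these generators take
  part, and by residues modulo \<open>3\<close> in the other rows.
\<close>

section \<open>Generating sets\<close>

lemma semigroup_span_subset:
  assumes "0 \<in> S" and add: "\<And>x y. x \<in> S \<Longrightarrow> y \<in> S \<Longrightarrow> x + y \<in> S" and "A \<subseteq> S"
  shows "semigroup_span A \<subseteq> S"
proof -
  have mult: "n * a \<in> S" if "a \<in> S" for n a :: nat
    by (induction n) (use that assms(1) add in auto)
  have "(\<Sum>a\<in>F. c a * a) \<in> S" if "finite F" "F \<subseteq> A" for F and c :: "nat \<Rightarrow> nat"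
    using that by (induction F) (use assms(1,3) mult add in auto)
  then show ?thesis
    unfolding semigroup_span_def by blast
qed

lemma semigroup_spanI:
  "finite F \<Longrightarrow> F \<subseteq> A \<Longrightarrow> (\<Sum>a\<in>F. c a * a) \<in> semigroup_span A"
  unfolding semigroup_span_def by blast

lemma combination_in_semigroup_span:
  assumes "a < b" "b < c"
  shows "x * a + y * b + z * c \<in> semigroup_span {a, b, c}"
proof -
  let ?c = "\<lambda>n. if n = a then x else if n = b then y else z"
  have "x * a + y * b + z * c = (\<Sum>n\<in>{a, b, c}. ?c n * n)"
    using assms by simp
  also have "\<dots> \<in> semigroup_span {a, b, c}"
    by (rule semigroup_spanI) auto
  finally show ?thesis .
qed

definition irreducible_in :: "nat set \<Rightarrow> nat \<Rightarrow> bool" where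
  "irreducible_in S a \<longleftrightarrow>
     a \<in> S \<and> a \<noteq> 0 \<and> (\<forall>x\<in>S. \<forall>y\<in>S. a = x + y \<longrightarrow> x = 0 \<or> y = 0)"

text \<open>Splitting one generator off a combination that represents the irreducible element leaves
  a remainder in the span, which must vanish.\<close>

lemma irreducible_in_generating_set:
  assumes irr: "irreducible_in (semigroup_span A) a"
  shows "a \<in> A"
proof -
  obtain F c where F: "finite F" "F \<subseteq> A" and a: "a = (\<Sum>f\<in>F. c f * f)"
    using irr unfolding irreducible_in_def semigroup_span_def by blast
  have "a \<noteq> 0"
    using irr by (simp add: irreducible_in_def)
  then obtain f where f: "f \<in> F" "c f * f \<noteq> 0"
    using a by (metis (no_types, lifting) sum.neutral)
  let ?c = "c(f := c f - 1)"
  let ?r = "\<Sum>g\<in>F. ?c g * g"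
  have "c f * f = f + (c f - 1) * f"
    using f(2) by (cases "c f") auto
  moreover have "(\<Sum>g\<in>F - {f}. ?c g * g) = (\<Sum>g\<in>F - {f}. c g * g)"
    by (intro sum.cong) auto
  ultimately have split: "a = f + ?r"
    using F(1) f(1) by (simp add: a sum.remove)
  have "?r \<in> semigroup_span A"
    using F by (rule semigroup_spanI)
  moreover have "f \<in> semigroup_span A"
    using semigroup_spanI[of "{f}" A "\<lambda>_. 1"] F(2) f(1) by auto
  ultimately have "?r = 0"
    using irr split f(2) unfolding irreducible_in_def by (metis mult_0_right)
  then show ?thesis
    using split F(2) f(1) by auto
qed

lemma minimal_generating_set_irreducibles:
  assumes span: "semigroup_span G = S" and irr: "\<And>a. a \<in> G \<Longrightarrow> irreducible_in S a"
  shows "minimal_generating_set S A \<longleftrightarrow> A = G"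
proof -
  have "G \<subseteq> B" if "semigroup_span B = S" for B
    using irreducible_in_generating_set irr that by blast
  then show ?thesis
    unfolding minimal_generating_set_def using span by blast
qed

section \<open>The conductor\<close>

text \<open>The integers outside \<open>S\<close> are unbounded below, so the maximum is taken over those that are
  at least \<open>-1\<close>; the bound \<open>-1\<close> keeps this finite set nonempty.\<close>

lemma conductor_greatest_gap:
  assumes "finite (- S)"
  shows "conductor S - 1 \<notin> int ` S" and "\<And>z. z \<notin> int ` S \<Longrightarrow> z \<le> conductor S - 1"
proof -
  let ?G = "{z. z \<notin> int ` S \<and> - 1 \<le> z}"
  have "z \<in> insert (- 1) (int ` (- S))" if "z \<in> ?G" for z
  proof (cases "z = - 1")
    case False
    then have "z = int (nat z)"
      using that by auto
    then show ?thesis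
      using that by (metis (no_types, lifting) ComplI imageI insertI2 mem_Collect_eq)
  qed simp
  then have fin: "finite ?G"
    using assms by (meson finite.insertI finite_imageI finite_subset subsetI)
  have m1: "- 1 \<in> ?G"
    by auto
  have mem: "Max ?G \<in> ?G"
    using Max_in[OF fin] m1 by blast
  have up: "z \<le> Max ?G" if "z \<notin> int ` S" for z
  proof (cases "- 1 \<le> z")
    case True
    then show ?thesis
      using that fin by simp
  next
    case False
    then show ?thesis
      using Max_ge[OF fin m1] by linarith
  qed
  have "(GREATEST z. z \<notin> int ` S) = Max ?G"
    by (rule Greatest_equality) (use mem up in auto)
  then have c: "conductor S - 1 = Max ?G"
    by (simp add: conductor_def)
  show "conductor S - 1 \<notin> int ` S"
    using mem c by simp
  show "z \<le> conductor S - 1" if "z \<notin> int ` S" for z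
    using up[OF that] c by simp
qed

section \<open>Arf semigroups of multiplicity 3 with conductor divisible by 3\<close>

lemma arf_multiplicity_3_eq:
  assumes sg: "numerical_semigroup S" and arf: "arf S" and mult: "multiplicity_sg S = 3"
    and cond: "conductor S = int (3 * k)" and "k \<ge> 1"
  shows "S = {n. 3 dvd n \<or> 3 * k \<le> n}"
proof -
  have zero: "0 \<in> S" and add: "\<And>x y. x \<in> S \<Longrightarrow> y \<in> S \<Longrightarrow> x + y \<in> S" and fin: "finite (- S)"
    using sg by (auto simp: numerical_semigroup_def)
  have "\<exists>n. n \<in> S \<and> n \<noteq> 0"
  proof (rule ccontr)
    assume "\<not> ?thesis"
    then have "UNIV \<subseteq> insert 0 (- S)"
      by auto
    then show False
      using fin by (metis finite.insertI infinite_UNIV_nat rev_finite_subset)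
  qed
  from LeastI_ex[OF this] have three: "3 \<in> S"
    using mult by (simp add: multiplicity_sg_def)
  have shift: "x + 3 * j \<in> S" if "x \<in> S" for x j
  proof (induction j)
    case (Suc j)
    then show ?case
      using add[OF Suc.IH three] by (simp add: algebra_simps)
  qed (use that in simp)
  have gap: "3 * k - 1 \<notin> S"
  proof
    assume "3 * k - 1 \<in> S"
    moreover have "conductor S - 1 = int (3 * k - 1)"
      using cond \<open>k \<ge> 1\<close> by simp
    ultimately show False
      using conductor_greatest_gap(1)[OF fin] by simp
  qed
  have large: "n \<in> S" if "3 * k \<le> n" for n
  proof (rule ccontr)
    assume "n \<notin> S"
    then have "int n \<notin> int ` S"
      by auto
    then show False
      using conductor_greatest_gap(2)[OF fin] that cond by fastforce
  qed
  have no2: "3 * m + 2 \<notin> S" if "m < k" for m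
  proof
    assume "3 * m + 2 \<in> S"
    then have "3 * m + 2 + 3 * (k - 1 - m) \<in> S"
      by (rule shift)
    moreover have "3 * m + 2 + 3 * (k - 1 - m) = 3 * k - 1"
      using that by (simp add: algebra_simps)
    ultimately show False
      using gap by metis
  qed
  have no1: "3 * m + 1 \<notin> S" if "m < k" for m
  proof
    assume "3 * m + 1 \<in> S"
    moreover have "3 * m \<in> S"
      using shift[OF zero, of m] by simp
    ultimately have "(3 * m + 1) + (3 * m + 1) - 3 * m \<in> S"
      using arf unfolding arf_def by (meson le_add1 order_refl)
    moreover have "(3 * m + 1) + (3 * m + 1) - 3 * m = 3 * m + 2"
      by simp
    ultimately show False
      using no2[OF that] by metis
  qed
  have "n \<in> S \<longleftrightarrow> 3 dvd n \<or> 3 * k \<le> n" for n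
  proof (cases "3 * k \<le> n")
    case False
    then have "n div 3 < k"
      by auto
    consider "n = 3 * (n div 3)" | "n = 3 * (n div 3) + 1" | "n = 3 * (n div 3) + 2"
      by linarith
    then show ?thesis
    proof cases
      case 1
      then show ?thesis
        using shift[OF zero, of "n div 3"] by (metis add_0 dvd_triv_left)
    next
      case 2
      then have "\<not> 3 dvd n"
        by presburger
      then show ?thesis
        using no1[OF \<open>n div 3 < k\<close>] 2 False by metis
    next
      case 3
      then have "\<not> 3 dvd n"
        by presburger
      then show ?thesis
        using no2[OF \<open>n div 3 < k\<close>] 3 False by metis
    qed
  qed (use large in simp)
  then show ?thesis
    by blast
qed

context
  fixes k :: nat and S :: "nat set"
  assumes k: "k \<ge> 1" and S: "S = {n. 3 dvd n \<or> 3 * k \<le> n}"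
begin

lemma semigroup_span_generators: "semigroup_span {3, 3 * k + 1, 3 * k + 2} = S"
proof (rule antisym)
  show "semigroup_span {3, 3 * k + 1, 3 * k + 2} \<subseteq> S"
    by (rule semigroup_span_subset) (auto simp: S)
next
  show "S \<subseteq> semigroup_span {3, 3 * k + 1, 3 * k + 2}"
  proof
    fix n assume "n \<in> S"
    then have n: "3 dvd n \<or> 3 * k \<le> n"
      by (simp add: S)
    have comb: "x * 3 + y * (3 * k + 1) + z * (3 * k + 2)
        \<in> semigroup_span {3, 3 * k + 1, 3 * k + 2}" for x y z
      using k by (intro combination_in_semigroup_span) auto
    consider "n = (n div 3) * 3 + 0 * (3 * k + 1) + 0 * (3 * k + 2)"
      | "n = (n div 3 - k) * 3 + 1 * (3 * k + 1) + 0 * (3 * k + 2)"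
      | "n = (n div 3 - k) * 3 + 0 * (3 * k + 1) + 1 * (3 * k + 2)"
      using n by fastforce
    then show "n \<in> semigroup_span {3, 3 * k + 1, 3 * k + 2}"
      using comb by cases metis+
  qed
qed

text \<open>A nonzero element of \<open>S\<close> is at least \<open>3\<close>, so \<open>3\<close> is not a sum of two of them, and if \<open>3 k + 1\<close>
  or \<open>3 k + 2\<close> were, both summands would be less than \<open>3 k\<close>. They would then be multiples of \<open>3\<close>,
  which the sum is not.\<close>

lemma irreducible_generators:
  assumes "a \<in> {3, 3 * k + 1, 3 * k + 2}"
  shows "irreducible_in S a"
proof -
  have "x = 0 \<or> y = 0" if xy: "x \<in> S" "y \<in> S" "a = x + y" for x y
  proof (rule ccontr)
    assume "\<not> (x = 0 \<or> y = 0)"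
    moreover have "n \<ge> 3" if "n \<in> S" "n \<noteq> 0" for n
      using that k by (auto simp: S dest: dvd_imp_le)
    ultimately have "x \<ge> 3" "y \<ge> 3"
      using xy by auto
    then have "x < 3 * k" "y < 3 * k" "a \<noteq> 3"
      using xy(3) assms by auto
    then have "3 dvd x + y"
      using xy(1,2) by (simp add: S)
    then show False
      using xy(3) assms \<open>a \<noteq> 3\<close> by auto presburger+
  qed
  then show ?thesis
    using assms unfolding irreducible_in_def by (auto simp: S)
qed

lemma minimal_generators:
  "minimal_generating_set S A \<longleftrightarrow> A = {3, 3 * k + 1, 3 * k + 2}"
  by (rule minimal_generating_set_irreducibles)
    (use semigroup_span_generators irreducible_generators in auto)

lemma pseudo_frobenius_eq: "pseudo_frobenius S = {int (3 * k) - 2, int (3 * k) - 1}"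
proof -
  have int_S: "z \<in> int ` S \<longleftrightarrow> 0 \<le> z \<and> (3 dvd z \<or> int (3 * k) \<le> z)" for z
  proof (cases "0 \<le> z")
    case True
    then obtain n where "z = int n"
      using nonneg_int_cases by blast
    moreover have "(3 :: int) dvd int n \<longleftrightarrow> 3 dvd n"
      by presburger
    ultimately show ?thesis
      by (auto simp: S)
  qed auto
  show ?thesis
  proof (intro equalityI subsetI)
    fix z assume "z \<in> pseudo_frobenius S"
    then have z: "z \<notin> int ` S" "\<And>x. x \<in> S \<Longrightarrow> x \<noteq> 0 \<Longrightarrow> z + int x \<in> int ` S"
      by (auto simp: pseudo_frobenius_def)
    \<comment> \<open>Adding \<open>3\<close> leaves \<open>-3\<close> as the only negative candidate; adding \<open>3 k + 1\<close> excludes it.\<close>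
    have "z + 3 \<in> int ` S" "z + int (3 * k + 1) \<in> int ` S"
      using z(2)[of 3] z(2)[of "3 * k + 1"] by (auto simp: S)
    then show "z \<in> {int (3 * k) - 2, int (3 * k) - 1}"
      using z(1) k unfolding int_S by simp presburger
  next
    fix z assume z: "z \<in> {int (3 * k) - 2, int (3 * k) - 1}"
    then have "z \<notin> int ` S"
      using k unfolding int_S by simp presburger
    moreover have "z + int x \<in> int ` S" if "x \<in> S" "x \<noteq> 0" for x
    proof -
      have "x \<ge> 3"
        using that k by (auto simp: S dest: dvd_imp_le)
      then show ?thesis
        using z k unfolding int_S by auto
    qed
    ultimately show "z \<in> pseudo_frobenius S"
      by (simp add: pseudo_frobenius_def)
  qed
qed

text \<open>Moving the diagonal entry \<open>-1\<close> to the other side turns each row into an equation between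
  nonnegative quantities in two unknowns.\<close>

lemma row_factorization_matrix_iff:
  assumes "f \<in> pseudo_frobenius S"
  shows "is_row_factorization_matrix S f M \<longleftrightarrow>
    M \<in> carrier_mat 3 3 \<and>
    (M $$ (0, 0) = - 1 \<and> 0 \<le> M $$ (0, 1) \<and> 0 \<le> M $$ (0, 2) \<and>
      M $$ (0, 1) * (3 * int k + 1) + M $$ (0, 2) * (3 * int k + 2) = f + 3) \<and>
    (M $$ (1, 1) = - 1 \<and> 0 \<le> M $$ (1, 0) \<and> 0 \<le> M $$ (1, 2) \<and>
      3 * M $$ (1, 0) + M $$ (1, 2) * (3 * int k + 2) = f + (3 * int k + 1)) \<and>
    (M $$ (2, 2) = - 1 \<and> 0 \<le> M $$ (2, 0) \<and> 0 \<le> M $$ (2, 1) \<and>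
      3 * M $$ (2, 0) + M $$ (2, 1) * (3 * int k + 1) = f + (3 * int k + 2))"
proof -
  let ?ns = "[3, 3 * k + 1, 3 * k + 2]"
  have "sorted_wrt (<) ns \<and> set ns = {3, 3 * k + 1, 3 * k + 2} \<longleftrightarrow> ns = ?ns" for ns
  proof
    assume "sorted_wrt (<) ns \<and> set ns = {3, 3 * k + 1, 3 * k + 2}"
    moreover have "sorted_wrt (<) ?ns" "set ?ns = {3, 3 * k + 1, 3 * k + 2}"
      using k by auto
    ultimately show "ns = ?ns"
      by (metis strict_sorted_equal)
  qed (use k in auto)
  then have ns: "(\<exists>ns. sorted_wrt (<) ns \<and> minimal_generating_set S (set ns) \<and> P ns) \<longleftrightarrow> P ?ns"
    for P
    unfolding minimal_generators by metis
  have all3: "(\<forall>i<3. P i) \<longleftrightarrow> P 0 \<and> P 1 \<and> P 2" for P :: "nat \<Rightarrow> bool"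
    by (auto simp: numeral_3_eq_3 numeral_2_eq_2 less_Suc_eq)
  have sum3: "(\<Sum>j<3. g j) = g 0 + g 1 + g 2" for g :: "nat \<Rightarrow> int"
    by (simp add: numeral_3_eq_3 numeral_2_eq_2)
  have len: "length ?ns = 3"
    by simp
  show ?thesis
    unfolding is_row_factorization_matrix_def ns len all3 sum3
    using assms by (auto simp: algebra_simps)
qed

end

section \<open>The rows of the matrices\<close>

lemma mat_3_3_eq_iff:
  "M = mat_of_rows_list 3 [[a, b, c], [d, e, f], [g, h, i]] \<longleftrightarrow>
    M \<in> carrier_mat 3 3 \<and>
    M $$ (0, 0) = a \<and> M $$ (0, 1) = b \<and> M $$ (0, 2) = c \<and>
    M $$ (1, 0) = d \<and> M $$ (1, 1) = e \<and> M $$ (1, 2) = f \<and>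
    M $$ (2, 0) = g \<and> M $$ (2, 1) = h \<and> M $$ (2, 2) = i"
  (is "M = ?N \<longleftrightarrow> ?entries")
proof
  assume M: "M = ?N"
  have "?N \<in> carrier_mat 3 3"
    by (rule carrier_matI) (simp_all add: mat_of_rows_list_def)
  then show ?entries
    unfolding M by (intro conjI) (simp_all add: mat_of_rows_list_def)
next
  assume entries: ?entries
  show "M = ?N"
  proof (rule eq_matI)
    fix i' j' assume "i' < dim_row ?N" "j' < dim_col ?N"
    then have "i' \<in> {0, 1, 2}" "j' \<in> {0, 1, 2}"
      by (auto simp: mat_of_rows_list_def)
    then show "M $$ (i', j') = ?N $$ (i', j')"
      using entries by (auto simp: mat_of_rows_list_def)
  qed (use entries in \<open>auto simp: mat_of_rows_list_def\<close>)
qed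

lemma coefficient_0_or_1:
  fixes x c r :: int
  assumes "0 \<le> x" "x * c \<le> r" "r < 2 * c" "0 < c"
  shows "x = 0 \<or> x = 1"
proof (rule ccontr)
  assume "\<not> ?thesis"
  then have "2 * c \<le> x * c"
    using assms by (intro mult_right_mono) auto
  then show False
    using assms by linarith
qed

lemma two_large_generators_solutions:
  fixes x y k :: int
  assumes "k \<ge> 1"
  shows "0 \<le> x \<and> 0 \<le> y \<and> x * (3 * k + 1) + y * (3 * k + 2) = 3 * k + 1 \<longleftrightarrow> x = 1 \<and> y = 0"
    and "0 \<le> x \<and> 0 \<le> y \<and> x * (3 * k + 1) + y * (3 * k + 2) = 3 * k + 2 \<longleftrightarrow> x = 0 \<and> y = 1"
proof -
  have bound: "x \<in> {0, 1} \<and> y \<in> {0, 1}"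
    if "0 \<le> x" "0 \<le> y" "x * (3 * k + 1) + y * (3 * k + 2) \<le> 3 * k + 2"
  proof -
    have "0 \<le> x * (3 * k + 1)" "0 \<le> y * (3 * k + 2)"
      using that assms by auto
    then have "x * (3 * k + 1) \<le> 3 * k + 2" "y * (3 * k + 2) \<le> 3 * k + 2"
      using that(3) by linarith+
    then show ?thesis
      using that coefficient_0_or_1[of x "3 * k + 1" "3 * k + 2"]
        coefficient_0_or_1[of y "3 * k + 2" "3 * k + 2"] assms by auto
  qed
  show "0 \<le> x \<and> 0 \<le> y \<and> x * (3 * k + 1) + y * (3 * k + 2) = 3 * k + 1 \<longleftrightarrow> x = 1 \<and> y = 0"
  proof
    assume sol: "0 \<le> x \<and> 0 \<le> y \<and> x * (3 * k + 1) + y * (3 * k + 2) = 3 * k + 1"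
    then have "x \<in> {0, 1} \<and> y \<in> {0, 1}"
      by (intro bound) auto
    then show "x = 1 \<and> y = 0"
      using sol assms by auto
  qed simp
  show "0 \<le> x \<and> 0 \<le> y \<and> x * (3 * k + 1) + y * (3 * k + 2) = 3 * k + 2 \<longleftrightarrow> x = 0 \<and> y = 1"
  proof
    assume sol: "0 \<le> x \<and> 0 \<le> y \<and> x * (3 * k + 1) + y * (3 * k + 2) = 3 * k + 2"
    then have "x \<in> {0, 1} \<and> y \<in> {0, 1}"
      by (intro bound) auto
    then show "x = 0 \<and> y = 1"
      using sol assms by auto
  qed simp
qed

text \<open>Only \<open>y = 0\<close> and \<open>y = 1\<close> are small enough, and the divisibility hypotheses single out one of
  them as the value for which \<open>r - y c\<close> is a multiple of \<open>3\<close>. Later, \<open>c\<close> is \<open>3 k + 1\<close> or \<open>3 k + 2\<close>.\<close>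

lemma one_large_generator_solutions:
  fixes x y c r :: int
  assumes "0 < c" "r < 2 * c"
  shows "3 dvd r \<Longrightarrow> 0 \<le> r \<Longrightarrow> \<not> 3 dvd r - c \<Longrightarrow>
      0 \<le> x \<and> 0 \<le> y \<and> 3 * x + y * c = r \<longleftrightarrow> x = r div 3 \<and> y = 0"
    and "\<not> 3 dvd r \<Longrightarrow> c \<le> r \<Longrightarrow> 3 dvd r - c \<Longrightarrow>
      0 \<le> x \<and> 0 \<le> y \<and> 3 * x + y * c = r \<longleftrightarrow> x = (r - c) div 3 \<and> y = 1"
proof -
  have "y = 0 \<or> y = 1" if "0 \<le> x" "0 \<le> y" "3 * x + y * c = r"
    using coefficient_0_or_1[of y c r] that assms by auto
  then show "3 dvd r \<Longrightarrow> 0 \<le> r \<Longrightarrow> \<not> 3 dvd r - c \<Longrightarrow>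
      0 \<le> x \<and> 0 \<le> y \<and> 3 * x + y * c = r \<longleftrightarrow> x = r div 3 \<and> y = 0"
    and "\<not> 3 dvd r \<Longrightarrow> c \<le> r \<Longrightarrow> 3 dvd r - c \<Longrightarrow>
      0 \<le> x \<and> 0 \<le> y \<and> 3 * x + y * c = r \<longleftrightarrow> x = (r - c) div 3 \<and> y = 1"
    by auto
qed

theorem proposition3p2:
  fixes S :: "nat set" and s :: nat
  assumes "numerical_semigroup S"
    and "arf S"
    and "multiplicity_sg S = 3"
    and "conductor S = int s"
    and "s \<ge> 3"
    and "[s = 0] (mod 3)"
  shows "S = semigroup_span {3, s + 1, s + 2} \<and>
    pseudo_frobenius S = {int s - 2, int s - 1} \<and>
    (\<forall>M. is_row_factorization_matrix S (int s - 2) M \<longleftrightarrow>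
       M = mat_of_rows_list 3
         [[-1, 1, 0],
          [(int s - 3) div 3, -1, 1],
          [(2 * int s) div 3, 0, -1]]) \<and>
    (\<forall>M. is_row_factorization_matrix S (int s - 1) M \<longleftrightarrow>
       M = mat_of_rows_list 3
         [[-1, 0, 1],
          [(2 * int s) div 3, -1, 0],
          [int s div 3, 1, -1]])"
proof -
  from assms(6) have "3 dvd s"
    by (simp add: cong_0_iff)
  then obtain k where s: "s = 3 * k"
    by (elim dvdE)
  have k: "k \<ge> 1"
    using assms(5) s by simp
  have S: "S = {n. 3 dvd n \<or> 3 * k \<le> n}"
    using arf_multiplicity_3_eq[OF assms(1-3) _ k] assms(4) s by simp
  have PF: "pseudo_frobenius S = {int s - 2, int s - 1}"
    using pseudo_frobenius_eq[OF k S] s by simp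
  let ?k = "int k"
  have k': "?k \<ge> 1"
    using k by simp
  have div: "(int s - 3) div 3 = ?k - 1" "(2 * int s) div 3 = 2 * ?k" "int s div 3 = ?k"
    using s by auto
  have ndvd: "\<not> (3 :: int) dvd 6 * ?k - 1" "\<not> (3 :: int) dvd 6 * ?k + 1"
    "\<not> (3 :: int) dvd 3 * ?k - 1" "\<not> (3 :: int) dvd 3 * ?k - 2"
    by presburger+
  \<comment> \<open>The second and third rows, for \<open>s - 2\<close> and then for \<open>s - 1\<close>.\<close>
  have rows:
    "0 \<le> x \<and> 0 \<le> y \<and> 3 * x + y * (3 * ?k + 2) = 6 * ?k - 1 \<longleftrightarrow> x = ?k - 1 \<and> y = 1"
    "0 \<le> x \<and> 0 \<le> y \<and> 3 * x + y * (3 * ?k + 1) = 6 * ?k \<longleftrightarrow> x = 2 * ?k \<and> y = 0"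
    "0 \<le> x \<and> 0 \<le> y \<and> 3 * x + y * (3 * ?k + 2) = 6 * ?k \<longleftrightarrow> x = 2 * ?k \<and> y = 0"
    "0 \<le> x \<and> 0 \<le> y \<and> 3 * x + y * (3 * ?k + 1) = 6 * ?k + 1 \<longleftrightarrow> x = ?k \<and> y = 1"
    for x y :: int
    using one_large_generator_solutions(2)[of "3 * ?k + 2" "6 * ?k - 1" x y]
      one_large_generator_solutions(1)[of "3 * ?k + 1" "6 * ?k" x y]
      one_large_generator_solutions(1)[of "3 * ?k + 2" "6 * ?k" x y]
      one_large_generator_solutions(2)[of "3 * ?k + 1" "6 * ?k + 1" x y] ndvd k'
    by (simp_all add: algebra_simps)
  have f1: "int s - 2 + 3 = 3 * ?k + 1" "int s - 2 + (3 * ?k + 1) = 6 * ?k - 1"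
      "int s - 2 + (3 * ?k + 2) = 6 * ?k"
    and f2: "int s - 1 + 3 = 3 * ?k + 2" "int s - 1 + (3 * ?k + 1) = 6 * ?k"
      "int s - 1 + (3 * ?k + 2) = 6 * ?k + 1"
    using s by simp_all
  show ?thesis
  proof (intro conjI allI)
    show "S = semigroup_span {3, s + 1, s + 2}"
      using semigroup_span_generators[OF k S] s by simp
    show "pseudo_frobenius S = {int s - 2, int s - 1}"
      by (rule PF)
    have "int s - 2 \<in> pseudo_frobenius S" "int s - 1 \<in> pseudo_frobenius S"
      using PF by auto
    note rf = this[THEN row_factorization_matrix_iff[OF k S]]
    fix M
    show "is_row_factorization_matrix S (int s - 2) M \<longleftrightarrow>
       M = mat_of_rows_list 3
         [[-1, 1, 0],
          [(int s - 3) div 3, -1, 1],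
          [(2 * int s) div 3, 0, -1]]"
      unfolding rf(1) f1 two_large_generators_solutions(1)[OF k'] rows(1,2)
        mat_3_3_eq_iff div
      by blast
    show "is_row_factorization_matrix S (int s - 1) M \<longleftrightarrow>
       M = mat_of_rows_list 3
         [[-1, 0, 1],
          [(2 * int s) div 3, -1, 0],
          [int s div 3, 1, -1]]"
      unfolding rf(2) f2 two_large_generators_solutions(2)[OF k'] rows(3,4)
        mat_3_3_eq_iff div
      by blast
  qed
qed

end
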